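(* Let $\mathcal{F}=\langle X,R^+,R^-\rangle$ be a collectively connected symmetric signed frame. Then $\mathcal{F}$ has the local weak balance property if and only if $R^+$ is collusive.
   Context: A symmetric signed frame is a tuple $\langle X,R^+,R^-\rangle$ with $X$ a set and $R^+,R^-\subseteq X\times X$ such that: $R^+$ is reflexive and symmetric; $R^-$ is symmetric; and $\forall x,y\in X.\ \neg(xR^+y)\vee\neg(xR^-y)$. It is collectively connected if moreover $\forall x,y\in X.\ (xR^+y \vee xR^-y)$. It has the local weak balance property iff for all $x,y,z\in X$: (1) $(xR^+y\wedge yR^+z)\Rightarrow xR^+z$, and (2) $((xR^+y\wedge yR^-z)\vee(xR^-y\wedge yR^+z))\Rightarrow xR^-z$. A relation $S$ on $X$ is collusive iff $\forall x,y,z,w\in X\,\big((xSy\wedge xSz\wedge wSy)\Rightarrow wSz\big)$. *)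

theory Defs
  imports Main
begin

definition symmetric_signed_frame :: "'a set \<Rightarrow> 'a rel \<Rightarrow> 'a rel \<Rightarrow> bool" where
  "symmetric_signed_frame X Rp Rm \<longleftrightarrow>
     Rp \<subseteq> X \<times> X \<and> Rm \<subseteq> X \<times> X \<and>
     refl_on X Rp \<and> sym Rp \<and> sym Rm \<and>
     (\<forall>x\<in>X. \<forall>y\<in>X. (x, y) \<notin> Rp \<or> (x, y) \<notin> Rm)"

definition collectively_connected :: "'a set \<Rightarrow> 'a rel \<Rightarrow> 'a rel \<Rightarrow> bool" where
  "collectively_connected X Rp Rm \<longleftrightarrow>
     (\<forall>x\<in>X. \<forall>y\<in>X. (x, y) \<in> Rp \<or> (x, y) \<in> Rm)"

definition local_weak_balance :: "'a set \<Rightarrow> 'a rel \<Rightarrow> 'a rel \<Rightarrow> bool" where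
  "local_weak_balance X Rp Rm \<longleftrightarrow>
     (\<forall>x\<in>X. \<forall>y\<in>X. \<forall>z\<in>X.
        ((x, y) \<in> Rp \<and> (y, z) \<in> Rp \<longrightarrow> (x, z) \<in> Rp) \<and>
        (((x, y) \<in> Rp \<and> (y, z) \<in> Rm) \<or> ((x, y) \<in> Rm \<and> (y, z) \<in> Rp) \<longrightarrow> (x, z) \<in> Rm))"

definition collusive :: "'a set \<Rightarrow> 'a rel \<Rightarrow> bool" where
  "collusive X S \<longleftrightarrow>
     (\<forall>x\<in>X. \<forall>y\<in>X. \<forall>z\<in>X. \<forall>w\<in>X.
        (x, y) \<in> S \<and> (x, z) \<in> S \<and> (w, y) \<in> S \<longrightarrow> (w, z) \<in> S)"

end

theory Submission
  imports Defs
begin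

text \<open>Connectedness and disjointness make \<open>Rm\<close> the complement of
  \<open>Rp\<close> on \<open>X\<close>. Both properties then amount to transitivity of the
  reflexive symmetric \<open>Rp\<close>, i.e. to \<open>Rp\<close> being an equivalence: the
  mixed-sign clause of balance follows by contradiction.\<close>

theorem mainTheorem9:
  fixes X :: "'a set" and Rp Rm :: "'a rel"
  assumes "symmetric_signed_frame X Rp Rm"
    and "collectively_connected X Rp Rm"
  shows "local_weak_balance X Rp Rm \<longleftrightarrow> collusive X Rp"
proof -
  have refl: "(x, x) \<in> Rp" if "x \<in> X" for x
    using assms(1) that unfolding symmetric_signed_frame_def refl_on_def by blast
  have sym: "(y, x) \<in> Rp" if "(x, y) \<in> Rp" for x y
    using assms(1) that unfolding symmetric_signed_frame_def sym_def by blast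
  have Rm_iff: "(x, y) \<in> Rm \<longleftrightarrow> (x, y) \<notin> Rp" if "x \<in> X" "y \<in> X" for x y
    using assms that unfolding symmetric_signed_frame_def collectively_connected_def by blast
  show ?thesis
  proof
    assume "local_weak_balance X Rp Rm"
    then have trans: "(x, z) \<in> Rp"
      if "(x, y) \<in> Rp" "(y, z) \<in> Rp" "x \<in> X" "y \<in> X" "z \<in> X" for x y z
      using that unfolding local_weak_balance_def by blast
    \<comment> \<open>Chain from \<open>w\<close> through \<open>y\<close> and \<open>x\<close> to
      \<open>z\<close>, reversing the edge from \<open>x\<close> to \<open>y\<close>.\<close>
    show "collusive X Rp"
      unfolding collusive_def by (blast intro: sym trans)
  next
    assume "collusive X Rp"
    then have trans: "(x, z) \<in> Rp"
      if "(x, y) \<in> Rp" "(y, z) \<in> Rp" "x \<in> X" "y \<in> X" "z \<in> X" for x y z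
      \<comment> \<open>Collusiveness is applied with \<open>y\<close> as the common source, its
        loop serving as the shared edge.\<close>
      using that refl[of y] unfolding collusive_def by blast
    have "(x, z) \<in> Rm"
      if "(x, y) \<in> Rp \<and> (y, z) \<in> Rm \<or> (x, y) \<in> Rm \<and> (y, z) \<in> Rp"
        and X: "x \<in> X" "y \<in> X" "z \<in> X" for x y z
      \<comment> \<open>If \<open>(x, z)\<close> were in \<open>Rp\<close>, transitivity would put
        \<open>(y, z)\<close> in \<open>Rp\<close> in the first case and \<open>(x, y)\<close> in
        the second, against \<open>Rm_iff\<close>.\<close>
      using that(1) Rm_iff X trans[of y x z] trans[of x z y] sym by blast
    then show "local_weak_balance X Rp Rm"
      unfolding local_weak_balance_def using trans by blast
  qed
qed

end
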